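(* $T_o[H^\infty]\subsetneqq A$.
   Context: $\mathbb{D}$ is the open unit disk, $H(\mathbb{D})$ the set of analytic functions on $\mathbb{D}$, $H^\infty$ the Banach space of bounded analytic functions on $\mathbb{D}$ with the supremum norm, and $A$ the disk algebra (analytic functions on $\mathbb{D}$ that extend to be continuous on $\overline{\mathbb{D}}$). For $g\in H(\mathbb{D})$, $T_gf(z)=\int_0^z f(t)g'(t)\,dt$, $z\in\mathbb{D}$, and $T_o[H^\infty]=\{g\in H(\mathbb{D}):T_g\text{ is a compact operator from }H^\infty\text{ into }H^\infty\}$. *)

theory Defs
  imports "HOL-Complex_Analysis.Complex_Analysis"
begin

abbreviation unit_disk :: "complex set" where
  "unit_disk \<equiv> ball 0 1"

text \<open>
  A function on the open unit disk is represented by the total function that agrees with it on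
  the disk and is \<^const>\<open>undefined\<close> elsewhere, so that equality in HOL is equality on the disk.
\<close>

definition H_disk :: "(complex \<Rightarrow> complex) set" where
  "H_disk = {f \<in> extensional unit_disk. f holomorphic_on unit_disk}"

definition Hinf :: "(complex \<Rightarrow> complex) set" where
  "Hinf = {f \<in> H_disk. bounded (f ` unit_disk)}"

definition disk_algebra :: "(complex \<Rightarrow> complex) set" where
  "disk_algebra =
     {f \<in> H_disk. \<exists>h. continuous_on (closure unit_disk) h \<and> (\<forall>z\<in>unit_disk. h z = f z)}"

definition hinf_norm :: "(complex \<Rightarrow> complex) \<Rightarrow> real" where
  "hinf_norm f = (SUP z\<in>unit_disk. norm (f z))"

text \<open>
  The locale \<^locale>\<open>Metric_space\<close> demands nonnegativity of the distance for all arguments, also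
  outside the carrier; hence the value 0 there.
\<close>

definition hinf_dist :: "(complex \<Rightarrow> complex) \<Rightarrow> (complex \<Rightarrow> complex) \<Rightarrow> real" where
  "hinf_dist f h = (if f \<in> Hinf \<and> h \<in> Hinf then hinf_norm (\<lambda>z. f z - h z) else 0)"

lemma hinf_norm_upper:
  assumes "bounded (f ` unit_disk)" "z \<in> unit_disk"
  shows "norm (f z) \<le> hinf_norm f"
  unfolding hinf_norm_def
proof (rule cSUP_upper)
  show "bdd_above ((\<lambda>z. norm (f z)) ` unit_disk)"
    using assms(1) by (auto simp: bounded_iff bdd_above_def)
qed (use assms in auto)

lemma hinf_dist_upper:
  assumes "f \<in> Hinf" "h \<in> Hinf" "z \<in> unit_disk"
  shows "norm (f z - h z) \<le> hinf_dist f h"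
proof -
  have "bounded ((\<lambda>z. f z - h z) ` unit_disk)"
    using assms by (intro bounded_minus_comp) (auto simp: Hinf_def)
  from hinf_norm_upper[OF this assms(3)] show ?thesis
    using assms by (simp add: hinf_dist_def)
qed

interpretation Hinf: Metric_space Hinf hinf_dist
proof
  show "0 \<le> hinf_dist f h" for f h
  proof (cases "f \<in> Hinf \<and> h \<in> Hinf")
    case True
    then have "norm (f 0 - h 0) \<le> hinf_dist f h"
      by (intro hinf_dist_upper) auto
    then show ?thesis
      by (meson norm_ge_zero order_trans)
  qed (auto simp: hinf_dist_def)
next
  show "hinf_dist f h = hinf_dist h f" for f h
    by (simp add: hinf_dist_def hinf_norm_def norm_minus_commute conj_commute)
next
  fix f h assume *: "f \<in> Hinf" "h \<in> Hinf"
  show "hinf_dist f h = 0 \<longleftrightarrow> f = h"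
  proof
    assume 0: "hinf_dist f h = 0"
    have "f z = h z" if "z \<in> unit_disk" for z
      using hinf_dist_upper[OF * that] 0 by simp
    then show "f = h"
      using * by (intro extensionalityI[of f unit_disk h]) (auto simp: Hinf_def H_disk_def)
  qed (simp add: hinf_dist_def hinf_norm_def)
next
  fix f g h assume *: "f \<in> Hinf" "g \<in> Hinf" "h \<in> Hinf"
  have "norm (f z - h z) \<le> hinf_dist f g + hinf_dist g h" if z: "z \<in> unit_disk" for z
  proof -
    have "norm (f z - h z) \<le> norm (f z - g z) + norm (g z - h z)"
      by (metis dist_norm dist_triangle)
    then show ?thesis
      using hinf_dist_upper[OF *(1,2) z] hinf_dist_upper[OF *(2,3) z] by linarith
  qed
  then have "hinf_norm (\<lambda>z. f z - h z) \<le> hinf_dist f g + hinf_dist g h"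
    unfolding hinf_norm_def by (intro cSUP_least) auto
  then show "hinf_dist f h \<le> hinf_dist f g + hinf_dist g h"
    using * by (simp add: hinf_dist_def)
qed

definition linear_on_Hinf :: "((complex \<Rightarrow> complex) \<Rightarrow> (complex \<Rightarrow> complex)) \<Rightarrow> bool" where
  "linear_on_Hinf T \<longleftrightarrow>
     (\<forall>f\<in>Hinf. \<forall>h\<in>Hinf. \<forall>a b :: complex.
        T (\<lambda>z\<in>unit_disk. a * f z + b * h z) = (\<lambda>z\<in>unit_disk. a * T f z + b * T h z))"

definition compact_operator_Hinf :: "((complex \<Rightarrow> complex) \<Rightarrow> (complex \<Rightarrow> complex)) \<Rightarrow> bool" where
  "compact_operator_Hinf T \<longleftrightarrow>
     T \<in> Hinf \<rightarrow> Hinf \<and> linear_on_Hinf T \<and>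
     (\<forall>B. Hinf.mbounded B \<longrightarrow> compactin Hinf.mtopology (Hinf.mtopology closure_of (T ` B)))"

definition T_op :: "(complex \<Rightarrow> complex) \<Rightarrow> (complex \<Rightarrow> complex) \<Rightarrow> (complex \<Rightarrow> complex)" where
  "T_op g f = (\<lambda>z\<in>unit_disk. contour_integral (linepath 0 z) (\<lambda>t. f t * deriv g t))"

definition T_compact :: "(complex \<Rightarrow> complex) set" where
  "T_compact = {g \<in> H_disk. compact_operator_Hinf (T_op g)}"

end

theory Submission
  imports Defs "HOL-Real_Asymp.Real_Asymp"
begin

text \<open>
  Suppose that \<open>T_g\<close> is compact.  Then \<open>g - g(0) = T_g 1\<close> is bounded.  If \<open>g\<close> were not in the
  disk algebra, it would not be uniformly continuous on the disk, so it would oscillate by a fixed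
  amount \<open>e > 0\<close> between points \<open>z_n\<close>, \<open>w_n\<close> that both converge to some boundary point \<open>c\<close>.  Test
  \<open>T_g\<close> on the powers \<open>f_m\<close> of the function \<open>(1 + conj(c) z) / 2\<close>, which is \<open>1\<close> at \<open>c\<close> and smaller
  than \<open>1\<close> in modulus inside the disk.  For fixed \<open>m\<close>, the function \<open>T_g f_m - f_m g\<close> has the
  bounded derivative \<open>- f_m' g\<close> and hence is Lipschitz; so near \<open>c\<close> the function \<open>T_g f_m\<close> inherits
  the oscillation of \<open>g\<close> (lemma \<open>T_op_inherits_oscillation\<close>), and this holds for
  every \<open>m\<close>.  But \<open>f_m \<rightarrow> 0\<close> locally uniformly, so \<open>T_g f_m \<rightarrow> 0\<close> pointwise, and compactness
  turns this into convergence in norm along a subsequence (lemma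
  \<open>compact_operator_null_subsequence\<close>).  That is a contradiction.

  The inclusion is strict because membership in the disk algebra does not even make \<open>T_g\<close> map
  bounded functions to bounded functions.  With \<open>L(z) = 1 - log(1 - z)\<close>, the function
  \<open>g(z) = (1 - z)^(-i) / L(z)\<close> extends continuously to the closed disk, as the bounded oscillating
  numerator is damped by \<open>1 / L(z) \<rightarrow> 0\<close> at \<open>1\<close>.  The bounded function \<open>f(z) = (1 - z)^i\<close> undoes
  the oscillation, and \<open>f g'\<close> has the primitive \<open>i log L + 1 / L\<close>, which is unbounded at \<open>1\<close>.
\<close>

section \<open>The integral operator as a primitive\<close>

lemma T_op_0 [simp]: "T_op g f 0 = 0"
  by (simp add: T_op_def)

lemma T_op_eq_primitive:
  assumes "\<And>z. z \<in> unit_disk \<Longrightarrow> (F has_field_derivative f z * deriv g z) (at z)"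
    and z: "z \<in> unit_disk"
  shows "T_op g f z = F z - F 0"
proof -
  have "path_image (linepath 0 z) \<subseteq> unit_disk"
    using z by (simp add: closed_segment_subset)
  then have "((\<lambda>t. f t * deriv g t) has_contour_integral F z - F 0) (linepath 0 z)"
    using contour_integral_primitive[of unit_disk F "\<lambda>t. f t * deriv g t" "linepath 0 z"] assms(1)
    by (auto intro: has_field_derivative_at_within)
  then show ?thesis
    using z by (simp add: T_op_def contour_integral_unique)
qed

lemma has_field_derivative_T_op:
  assumes g: "g holomorphic_on unit_disk" and f: "f holomorphic_on unit_disk"
    and z: "z \<in> unit_disk"
  shows "(T_op g f has_field_derivative f z * deriv g z) (at z)"
proof -
  have "(\<lambda>t. f t * deriv g t) holomorphic_on unit_disk"
    using f g by (intro holomorphic_intros) auto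
  then obtain F where F: "\<And>x. x \<in> unit_disk \<Longrightarrow>
      (F has_field_derivative f x * deriv g x) (at x within unit_disk)"
    using holomorphic_convex_primitive'[of unit_disk "\<lambda>t. f t * deriv g t"] by auto
  then have F': "(F has_field_derivative f x * deriv g x) (at x)" if "x \<in> unit_disk" for x
    using that by (metis at_within_open open_ball)
  have "((\<lambda>z. F z - F 0) has_field_derivative f z * deriv g z) (at z)"
    using F'[OF z] by (auto intro!: derivative_eq_intros)
  then show ?thesis
    by (rule has_field_derivative_transform_within_open[OF _ open_ball z])
       (use T_op_eq_primitive[OF F'] in auto)
qed

section \<open>Compactness of the operator forces uniform continuity of the symbol\<close>

lemma T_compact_bounded:
  assumes "g \<in> T_compact"
  shows "bounded (g ` unit_disk)"
proof -
  have g: "g holomorphic_on unit_disk"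
    using assms by (auto simp: T_compact_def H_disk_def)
  define u where "u = (\<lambda>z\<in>unit_disk. 1 :: complex)"
  have "u holomorphic_on unit_disk"
    by (rule holomorphic_transform[of "\<lambda>_. 1"]) (auto simp: u_def)
  then have "u \<in> Hinf"
    by (auto simp: Hinf_def H_disk_def u_def bounded_iff intro!: exI[of _ 1])
  then have "T_op g u \<in> Hinf"
    using assms by (auto simp: T_compact_def compact_operator_Hinf_def)
  then obtain B where B: "\<And>z. z \<in> unit_disk \<Longrightarrow> norm (T_op g u z) \<le> B"
    unfolding Hinf_def bounded_iff by blast
  have "norm (g z) \<le> B + norm (g 0)" if z: "z \<in> unit_disk" for z
  proof -
    have "T_op g u z = g z - g 0"
      by (rule T_op_eq_primitive[OF _ z]) (simp add: u_def holomorphic_derivI[OF g open_ball])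
    then show ?thesis
      using B[OF z] norm_triangle_sub[of "g z" "g 0"] by simp
  qed
  then show ?thesis
    unfolding bounded_iff by blast
qed

text \<open>
  Compactness provides a norm limit along a subsequence, and pointwise convergence identifies
  this limit as zero.
\<close>

lemma compact_operator_null_subsequence:
  assumes T: "compact_operator_Hinf T"
    and f: "\<And>m. f m \<in> Hinf" "\<And>m z. z \<in> unit_disk \<Longrightarrow> norm (f m z) \<le> C"
    and lim0: "\<And>z. z \<in> unit_disk \<Longrightarrow> (\<lambda>m. T (f m) z) \<longlonglongrightarrow> 0"
    and "e > 0"
  obtains m :: nat where "\<And>z. z \<in> unit_disk \<Longrightarrow> norm (T (f m) z) < e"
proof -
  have Tf: "T (f m) \<in> Hinf" for m
    using T f(1) by (auto simp: compact_operator_Hinf_def)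
  have "hinf_dist (f 0) (f m) \<le> C + C" for m
  proof -
    have "hinf_norm (\<lambda>z. f 0 z - f m z) \<le> C + C"
      unfolding hinf_norm_def
    proof (rule cSUP_least)
      fix z :: complex assume "z \<in> unit_disk"
      then show "norm (f 0 z - f m z) \<le> C + C"
        using f(2)[of z 0] f(2)[of z m] norm_triangle_ineq4[of "f 0 z" "f m z"] by linarith
    qed auto
    then show ?thesis
      using f(1) by (simp add: hinf_dist_def)
  qed
  then have "Hinf.mbounded (range f)"
    unfolding Hinf.mbounded_def using f(1)
    by (intro exI[of _ "f 0"] exI[of _ "C + C"]) (auto simp: Hinf.mcball_def)
  then have comp: "compactin Hinf.mtopology (Hinf.mtopology closure_of (T ` range f))"
    using T by (auto simp: compact_operator_Hinf_def)
  have sub: "range (\<lambda>m. T (f m)) \<subseteq> Hinf.mtopology closure_of (T ` range f)"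
    using closure_of_subset[of "T ` range f" Hinf.mtopology] Tf
    by (auto simp: image_image)
  obtain l r where l: "l \<in> Hinf" and r: "strict_mono (r :: nat \<Rightarrow> nat)"
    and lim: "limitin Hinf.mtopology ((\<lambda>m. T (f m)) \<circ> r) l sequentially"
    using comp sub unfolding Hinf.compactin_sequentially by (meson subsetD)
  have ev: "\<forall>\<^sub>F n in sequentially. hinf_dist (T (f (r n))) l < d" if "d > 0" for d
    using lim that unfolding Hinf.limitin_metric by (auto elim!: eventually_mono)
  have l0: "l z = 0" if z: "z \<in> unit_disk" for z
  proof -
    have "(\<lambda>n. T (f (r n)) z) \<longlonglongrightarrow> l z"
    proof (rule tendstoI)
      fix d :: real assume "d > 0"
      show "\<forall>\<^sub>F n in sequentially. dist (T (f (r n)) z) (l z) < d"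
        using ev[OF \<open>d > 0\<close>]
        by (rule eventually_mono)
           (use hinf_dist_upper[OF Tf l z] in \<open>auto simp: dist_norm intro: le_less_trans\<close>)
    qed
    moreover have "(\<lambda>n. T (f (r n)) z) \<longlonglongrightarrow> 0"
      using LIMSEQ_subseq_LIMSEQ[OF lim0[OF z] r] by (simp add: o_def)
    ultimately show ?thesis
      by (rule LIMSEQ_unique)
  qed
  obtain n where n: "hinf_dist (T (f (r n))) l < e"
    using eventually_happens[OF ev[OF \<open>e > 0\<close>]] by auto
  show ?thesis
  proof
    fix z :: complex assume "z \<in> unit_disk"
    then show "norm (T (f (r n)) z) < e"
      using hinf_dist_upper[OF Tf[of "r n"] l, of z] n l0 by simp
  qed
qed

text \<open>
  Integration by parts without integrals: \<open>T_op g f\<close> differs from \<open>f g\<close> by a function with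
  derivative \<open>- f' g\<close>, which is Lipschitz; and multiplication by \<open>f\<close> preserves the oscillation of
  \<open>g\<close> at a point where \<open>f\<close> is close to \<open>1\<close>.
\<close>

lemma T_op_inherits_oscillation:
  assumes g: "g holomorphic_on unit_disk" and M: "\<And>z. z \<in> unit_disk \<Longrightarrow> norm (g z) \<le> M"
    and f: "f holomorphic_on unit_disk"
    and K: "\<And>z. z \<in> unit_disk \<Longrightarrow> norm (deriv f z) \<le> K"
    and zw: "\<And>n. z n \<in> unit_disk" "\<And>n. w n \<in> unit_disk"
    and lim: "(\<lambda>n. f (z n)) \<longlonglongrightarrow> 1" "(\<lambda>n. z n - w n) \<longlonglongrightarrow> 0"
    and osc: "\<And>n. norm (g (z n) - g (w n)) \<ge> e" and "e > 0"
  obtains n :: nat where "norm (T_op g f (z n) - T_op g f (w n)) > e / 2"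
proof -
  have "M \<ge> 0"
    using M[of 0] norm_ge_zero[of "g 0"] by (simp del: norm_ge_zero)
  have "K \<ge> 0"
    using K[of 0] norm_ge_zero[of "deriv f 0"] by (simp del: norm_ge_zero)
  define P where "P = (\<lambda>x. T_op g f x - f x * g x)"
  have P: "(P has_field_derivative - (deriv f x * g x)) (at x within unit_disk)"
    if "x \<in> unit_disk" for x
  proof -
    have "(P has_field_derivative f x * deriv g x - (deriv f x * g x + deriv g x * f x)) (at x)"
      unfolding P_def
      by (rule DERIV_diff[OF has_field_derivative_T_op[OF g f that] DERIV_mult[OF
            holomorphic_derivI[OF f open_ball that] holomorphic_derivI[OF g open_ball that]]])
    moreover have "f x * deriv g x - (deriv f x * g x + deriv g x * f x) = - (deriv f x * g x)"
      by simp
    ultimately show ?thesis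
      by (metis has_field_derivative_at_within)
  qed
  have lip_P: "norm (P a - P b) \<le> K * M * norm (a - b)"
    if "a \<in> unit_disk" "b \<in> unit_disk" for a b
    by (rule field_differentiable_bound[OF _ P _ that])
       (use K M \<open>K \<ge> 0\<close> in \<open>auto simp: norm_mult intro!: mult_mono\<close>)
  have lip_f: "norm (f a - f b) \<le> K * norm (a - b)"
    if "a \<in> unit_disk" "b \<in> unit_disk" for a b
    by (rule field_differentiable_bound[of unit_disk f "deriv f", OF _ _ _ that])
       (use K in \<open>auto intro: holomorphic_derivI[OF f open_ball]\<close>)
  have bound: "norm (T_op g f (z n) - T_op g f (w n))
      \<ge> norm (f (z n)) * e - K * M * norm (z n - w n) - K * M * norm (z n - w n)" for n
  proof -
    define a b where "a = z n" and "b = w n"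
    have ab: "a \<in> unit_disk" "b \<in> unit_disk"
      using zw by (auto simp: a_def b_def)
    have "f a * (g a - g b) =
        (T_op g f a - T_op g f b) - (P a - P b) - (f a - f b) * g b"
      by (simp add: P_def algebra_simps)
    then have "norm (f a * (g a - g b)) \<le>
        norm (T_op g f a - T_op g f b) + norm (P a - P b) + norm ((f a - f b) * g b)"
      using norm_triangle_ineq4[of "(T_op g f a - T_op g f b) - (P a - P b)" "(f a - f b) * g b"]
        norm_triangle_ineq4[of "T_op g f a - T_op g f b" "P a - P b"] by simp
    moreover have "norm (f a) * e \<le> norm (f a * (g a - g b))"
      using osc[of n] by (auto simp: norm_mult a_def b_def intro: mult_left_mono)
    moreover have "norm ((f a - f b) * g b) \<le> (K * norm (a - b)) * M"
      unfolding norm_mult using lip_f[OF ab] M[OF ab(2)] \<open>K \<ge> 0\<close> by (intro mult_mono) auto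
    ultimately show ?thesis
      using lip_P[OF ab] by (simp add: a_def b_def mult_ac)
  qed
  have "(\<lambda>n. norm (f (z n)) * e - K * M * norm (z n - w n) - K * M * norm (z n - w n))
      \<longlonglongrightarrow> norm (1 :: complex) * e - K * M * norm (0 :: complex) - K * M * norm (0 :: complex)"
    by (intro tendsto_intros lim)
  then have "\<forall>\<^sub>F n in sequentially. e / 2 <
      norm (f (z n)) * e - K * M * norm (z n - w n) - K * M * norm (z n - w n)"
    by (rule order_tendstoD) (use \<open>e > 0\<close> in simp)
  then obtain n where "e / 2 <
      norm (f (z n)) * e - K * M * norm (z n - w n) - K * M * norm (z n - w n)"
    using eventually_happens by force
  then show ?thesis
    using bound[of n] that[of n] by linarith
qed

text \<open>
  Failure of uniform continuity yields pairs of points that approach each other with \<open>g\<close>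
  oscillating between them; compactness of the closed disk lets them converge.
\<close>

lemma oscillation_at_boundary_point:
  fixes g :: "complex \<Rightarrow> complex"
  assumes cont: "continuous_on unit_disk g" and nuc: "\<not> uniformly_continuous_on unit_disk g"
  obtains c e z w where "norm c = 1" "e > 0"
    "\<And>n. z n \<in> unit_disk" "\<And>n. w n \<in> unit_disk" "z \<longlonglongrightarrow> c" "(\<lambda>n :: nat. z n - w n) \<longlonglongrightarrow> 0"
    "\<And>n. norm (g (z n) - g (w n)) \<ge> e"
proof -
  obtain e where "e > 0" and
    "\<forall>d>0. \<exists>x\<in>unit_disk. \<exists>y\<in>unit_disk. dist y x < d \<and> \<not> dist (g y) (g x) < e"
    using nuc unfolding uniformly_continuous_on_def by blast
  then have "\<forall>n. \<exists>x y. x \<in> unit_disk \<and> y \<in> unit_disk \<and> dist y x < inverse (real (Suc n)) \<and>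
      \<not> dist (g y) (g x) < e"
    by (metis inverse_positive_iff_positive of_nat_0_less_iff zero_less_Suc)
  then obtain w z where zw: "\<And>n. w n \<in> unit_disk" "\<And>n. z n \<in> unit_disk"
    "\<And>n. dist (z n) (w n) < inverse (real (Suc n))" "\<And>n. \<not> dist (g (z n)) (g (w n)) < e"
    by metis
  have "(\<lambda>n. z n - w n) \<longlonglongrightarrow> 0"
    by (rule Lim_null_comparison[OF _ LIMSEQ_inverse_real_of_nat])
       (use zw(3) in \<open>auto simp: dist_norm intro!: always_eventually less_imp_le\<close>)
  moreover have "\<forall>n. z n \<in> cball 0 1"
    using zw(2) by (simp add: less_imp_le)
  then obtain c r where c: "c \<in> cball 0 1" and r: "strict_mono (r :: nat \<Rightarrow> nat)"
    and zc: "(z \<circ> r) \<longlonglongrightarrow> c"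
    using compact_cball[of 0 "1 :: real"] unfolding compact_def by blast
  ultimately have zw0: "(\<lambda>n. z (r n) - w (r n)) \<longlonglongrightarrow> 0"
    using LIMSEQ_subseq_LIMSEQ[OF _ r] by (fastforce simp: o_def)
  have wc: "(w \<circ> r) \<longlonglongrightarrow> c"
    using tendsto_diff[OF zc zw0] by (simp add: o_def)
  have "norm c = 1"
  proof (rule ccontr)
    \<comment> \<open>Inside the disk, continuity at \<open>c\<close> rules out the oscillation.\<close>
    assume "norm c \<noteq> 1"
    then have "isCont g c"
      using c cont by (simp add: continuous_on_eq_continuous_at)
    then have "(\<lambda>n. dist (g ((z \<circ> r) n)) (g ((w \<circ> r) n))) \<longlonglongrightarrow> dist (g c) (g c)"
      by (intro tendsto_dist isCont_tendsto_compose[of c g] zc wc)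
    then have "\<forall>\<^sub>F n in sequentially. dist (g ((z \<circ> r) n)) (g ((w \<circ> r) n)) < e"
      by (rule order_tendstoD) (use \<open>e > 0\<close> in simp)
    then show False
      using zw(4) eventually_happens by force
  qed
  then show ?thesis
    by (rule that[OF _ \<open>e > 0\<close>, of _ "z \<circ> r" "w \<circ> r"])
       (use zw zc zw0 in \<open>auto simp: dist_norm not_less\<close>)
qed

text \<open>
  For \<open>c\<close> on the unit circle the base maps the disk into itself and peaks at \<open>c\<close> with value \<open>1\<close>:
  all powers keep the value \<open>1\<close> at \<open>c\<close>, but they tend to \<open>0\<close> in the disk.
\<close>

definition peak_power :: "complex \<Rightarrow> nat \<Rightarrow> complex \<Rightarrow> complex" where
  "peak_power c m = (\<lambda>z\<in>unit_disk. ((1 + cnj c * z) / 2) ^ m)"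

lemma peak_base_norm_le:
  assumes "norm c = 1"
  shows "norm ((1 + cnj c * z) / 2) \<le> (1 + norm z) / 2"
proof -
  have "norm ((1 + cnj c * z) / 2) = norm (1 + cnj c * z) / 2"
    by (simp only: norm_divide) simp
  moreover have "norm (1 + cnj c * z) \<le> 1 + norm z"
    using norm_triangle_ineq[of 1 "cnj c * z"] assms by (simp only: norm_mult) simp
  ultimately show ?thesis by simp
qed

lemma peak_power_holomorphic: "peak_power c m holomorphic_on unit_disk"
  by (rule holomorphic_transform[of "\<lambda>z. ((1 + cnj c * z) / 2) ^ m"])
     (auto simp: peak_power_def intro!: holomorphic_intros)

lemma peak_power_norm_le:
  assumes "norm c = 1" "z \<in> unit_disk"
  shows "norm (peak_power c m z) \<le> ((1 + norm z) / 2) ^ m"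
proof -
  have "peak_power c m z = ((1 + cnj c * z) / 2) ^ m"
    using assms by (simp add: peak_power_def)
  then show ?thesis
    using power_mono[OF peak_base_norm_le[OF assms(1), of z] norm_ge_zero, of m]
    by (simp only: norm_power)
qed

lemma peak_power_norm_le_1:
  assumes "norm c = 1" "z \<in> unit_disk"
  shows "norm (peak_power c m z) \<le> 1"
  by (rule order_trans[OF peak_power_norm_le[OF assms]], rule power_le_one) (use assms(2) in auto)

lemma peak_power_Hinf: "norm c = 1 \<Longrightarrow> peak_power c m \<in> Hinf"
  using peak_power_holomorphic[of c m] peak_power_norm_le_1[of c _ m]
  by (auto simp: Hinf_def H_disk_def peak_power_def[of c m] bounded_iff intro!: exI[of _ 1])

lemma deriv_peak_power_norm_le:
  assumes "norm c = 1" "z \<in> unit_disk"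
  shows "norm (deriv (peak_power c m) z) \<le> real m"
proof -
  have "((\<lambda>z. ((1 + cnj c * z) / 2) ^ m) has_field_derivative
      of_nat m * ((1 + cnj c * z) / 2) ^ (m - 1) * (cnj c / 2)) (at z)"
    by (auto intro!: derivative_eq_intros)
  then have "(peak_power c m has_field_derivative
      of_nat m * ((1 + cnj c * z) / 2) ^ (m - 1) * (cnj c / 2)) (at z)"
    by (rule has_field_derivative_transform_within_open[OF _ open_ball assms(2)]) (simp add: peak_power_def)
  then have "deriv (peak_power c m) z
      = of_nat m * ((1 + cnj c * z) / 2) ^ (m - 1) * (cnj c / 2)"
    by (rule DERIV_imp_deriv)
  moreover have "norm (((1 + cnj c * z) / 2) ^ (m - 1)) \<le> 1"
    unfolding norm_power using peak_base_norm_le[OF assms(1), of z] assms(2)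
    by (intro power_le_one) auto
  then have "real m * norm (((1 + cnj c * z) / 2) ^ (m - 1)) * (1 / 2) \<le> real m * 1 * 1"
    by (intro mult_mono) auto
  ultimately show ?thesis
    using assms(1) by (simp only: norm_mult norm_divide complex_mod_cnj norm_of_nat) simp
qed

lemma peak_power_tendsto_1:
  assumes "norm c = 1" "\<And>n. z n \<in> unit_disk" "z \<longlonglongrightarrow> c"
  shows "(\<lambda>n. peak_power c m (z n)) \<longlonglongrightarrow> 1"
proof -
  have "cnj c * c = 1"
    using assms(1) complex_norm_square[of c] by (simp add: mult.commute)
  then have "((1 + cnj c * c) / 2) ^ m = 1"
    by simp
  moreover have "(\<lambda>n. ((1 + cnj c * z n) / 2) ^ m) \<longlonglongrightarrow> ((1 + cnj c * c) / 2) ^ m"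
    by (intro tendsto_intros assms) auto
  ultimately show ?thesis
    using assms(2) by (simp add: peak_power_def)
qed

text \<open>
  On the disk of radius \<open>norm z\<close> the derivative of \<open>T_op g (peak_power c m)\<close> is bounded by a fixed
  constant times \<open>q ^ m\<close> with \<open>q < 1\<close>.
\<close>

lemma T_op_peak_power_tendsto_0:
  assumes g: "g holomorphic_on unit_disk" and c: "norm c = 1" and z: "z \<in> unit_disk"
  shows "(\<lambda>m. T_op g (peak_power c m) z) \<longlonglongrightarrow> 0"
proof -
  define S where "S = cball (0 :: complex) (norm z)"
  define q where "q = (1 + norm z) / 2"
  have q: "0 \<le> q" "q < 1"
    using z by (auto simp: q_def)
  have sub: "S \<subseteq> unit_disk"
    using z by (auto simp: S_def)
  have "continuous_on S (deriv g)"
    using g sub by (intro holomorphic_on_imp_continuous_on holomorphic_on_subset[OF _ sub])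
      (auto intro: holomorphic_deriv)
  then have "bounded (deriv g ` S)"
    by (intro compact_imp_bounded compact_continuous_image) (auto simp: S_def)
  then obtain C where C: "\<And>x. x \<in> S \<Longrightarrow> norm (deriv g x) \<le> C"
    by (auto simp: bounded_iff)
  have bound: "norm (T_op g (peak_power c m) z) \<le> q ^ m * C * norm z" for m
  proof -
    have "norm (T_op g (peak_power c m) z - T_op g (peak_power c m) 0) \<le> q ^ m * C * norm (z - 0)"
    proof (rule field_differentiable_bound[of S _ "\<lambda>x. peak_power c m x * deriv g x"])
      fix x assume x: "x \<in> S"
      with sub have xd: "x \<in> unit_disk" by auto
      show "(T_op g (peak_power c m) has_field_derivative peak_power c m x * deriv g x)
          (at x within S)"
        by (rule has_field_derivative_at_within[OF
              has_field_derivative_T_op[OF g peak_power_holomorphic xd]])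
      have "norm (peak_power c m x) \<le> q ^ m"
        by (rule order_trans[OF peak_power_norm_le[OF c xd]], rule power_mono)
           (use x in \<open>auto simp: S_def q_def\<close>)
      then show "norm (peak_power c m x * deriv g x) \<le> q ^ m * C"
        unfolding norm_mult using C[OF x] q by (intro mult_mono) auto
    qed (auto simp: S_def)
    then show ?thesis by simp
  qed
  have "(\<lambda>m. q ^ m * C * norm z) \<longlonglongrightarrow> 0 * C * norm z"
    using q by (intro tendsto_intros LIMSEQ_realpow_zero)
  then have "(\<lambda>m. q ^ m * C * norm z) \<longlonglongrightarrow> 0"
    by simp
  with always_eventually[OF allI[OF bound]] show ?thesis
    by (rule Lim_null_comparison)
qed

lemma T_compact_uniformly_continuous:
  assumes gT: "g \<in> T_compact"
  shows "uniformly_continuous_on unit_disk g"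
proof (rule ccontr)
  assume nuc: "\<not> uniformly_continuous_on unit_disk g"
  have g: "g holomorphic_on unit_disk" and T: "compact_operator_Hinf (T_op g)"
    using gT by (auto simp: T_compact_def H_disk_def)
  obtain M where M: "\<And>z. z \<in> unit_disk \<Longrightarrow> norm (g z) \<le> M"
    using T_compact_bounded[OF gT] unfolding bounded_iff by blast
  obtain c e z w where c: "norm c = 1" and e: "e > 0"
    and zw: "\<And>n. z n \<in> unit_disk" "\<And>n. w n \<in> unit_disk"
    and lim: "z \<longlonglongrightarrow> c" "(\<lambda>n :: nat. z n - w n) \<longlonglongrightarrow> 0"
    and osc: "\<And>n. norm (g (z n) - g (w n)) \<ge> e"
    by (rule oscillation_at_boundary_point[OF holomorphic_on_imp_continuous_on[OF g] nuc])
       (rule that; assumption)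
  obtain m where m: "\<And>x. x \<in> unit_disk \<Longrightarrow> norm (T_op g (peak_power c m) x) < e / 4"
    by (rule compact_operator_null_subsequence[of "T_op g" "peak_power c" 1 "e / 4"])
       (use T c e peak_power_Hinf peak_power_norm_le_1 T_op_peak_power_tendsto_0[OF g] in auto)
  obtain n where
    "norm (T_op g (peak_power c m) (z n) - T_op g (peak_power c m) (w n)) > e / 2"
    using T_op_inherits_oscillation[OF g M peak_power_holomorphic deriv_peak_power_norm_le[OF c]
        zw peak_power_tendsto_1[OF c zw(1) lim(1)] lim(2) osc e] .
  then show False
    using m[OF zw(1)[of n]] m[OF zw(2)[of n]]
      norm_triangle_ineq4[of "T_op g (peak_power c m) (z n)" "T_op g (peak_power c m) (w n)"]
    by linarith
qed

lemma T_compact_subset_disk_algebra: "T_compact \<subseteq> disk_algebra"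
proof
  fix g assume g: "g \<in> T_compact"
  obtain h where "uniformly_continuous_on (closure unit_disk) h" "\<And>x. x \<in> unit_disk \<Longrightarrow> g x = h x"
    using uniformly_continuous_on_extension_on_closure[OF T_compact_uniformly_continuous[OF g]]
    by metis
  then show "g \<in> disk_algebra"
    using g by (auto simp: disk_algebra_def T_compact_def
        intro!: exI[of _ h] uniformly_continuous_imp_continuous)
qed

section \<open>A symbol in the disk algebra with an unbounded operator\<close>

abbreviation logL :: "complex \<Rightarrow> complex" where
  "logL z \<equiv> 1 - Ln (1 - z)"

lemma one_minus_in_half_plane:
  fixes z :: complex
  assumes "z \<in> cball 0 1" "z \<noteq> 1"
  shows "Re (1 - z) > 0"
proof (rule ccontr)
  assume "\<not> Re (1 - z) > 0"
  then have "Re z \<ge> 1" by simp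
  moreover have "Re z \<le> 1" "norm z \<le> 1"
    using assms(1) complex_Re_le_cmod[of z] by auto
  ultimately have "Re z = 1" "(Re z)\<^sup>2 + (Im z)\<^sup>2 \<le> 1"
    by (auto simp: cmod_def)
  then have "z = 1"
    by (auto simp: complex_eq_iff)
  with assms(2) show False by simp
qed

lemma one_minus_nonpos_Reals:
  fixes z :: complex
  assumes "z \<in> cball 0 1" "z \<noteq> 1"
  shows "1 - z \<notin> \<real>\<^sub>\<le>\<^sub>0"
  using one_minus_in_half_plane[OF assms] by (auto simp: complex_nonpos_Reals_iff)

text \<open>The summand \<open>1\<close> in \<open>logL\<close> exceeds \<open>ln 2\<close>, the largest real part of \<open>Ln (1 - z)\<close> on the
  closed disk.\<close>

lemma Re_logL_pos:
  assumes "z \<in> cball 0 1" "z \<noteq> 1"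
  shows "Re (logL z) > 0"
proof -
  have "norm (1 - z) \<le> 2"
    using norm_triangle_ineq4[of 1 z] assms by simp
  then have "ln (norm (1 - z)) \<le> ln 2"
    using assms by simp
  also have "\<dots> < (1 :: real)"
    using ln_less_self[of "2 :: real"] ln_2_less_1 by simp
  finally show ?thesis
    using assms by simp
qed

lemma norm_exp_i_Ln_le:
  assumes "x \<noteq> 0" "a = \<i> \<or> a = - \<i>"
  shows "norm (exp (a * Ln x)) \<le> exp pi"
proof -
  have "Re (a * Ln x) \<le> pi"
    using assms mpi_less_Im_Ln[OF assms(1)] Im_Ln_le_pi[OF assms(1)] by auto
  then show ?thesis by simp
qed

definition oscillating_symbol :: "complex \<Rightarrow> complex" where
  "oscillating_symbol = (\<lambda>z\<in>unit_disk. exp (- \<i> * Ln (1 - z)) / logL z)"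

definition bounded_oscillation :: "complex \<Rightarrow> complex" where
  "bounded_oscillation = (\<lambda>z\<in>unit_disk. exp (\<i> * Ln (1 - z)))"

lemma disk_facts:
  assumes "z \<in> unit_disk"
  shows "1 - z \<notin> \<real>\<^sub>\<le>\<^sub>0" "Re (logL z) > 0" "logL z \<noteq> 0" "1 - z \<noteq> 0"
proof -
  have *: "z \<in> cball 0 1" "z \<noteq> 1" using assms by auto
  show "1 - z \<notin> \<real>\<^sub>\<le>\<^sub>0" by (rule one_minus_nonpos_Reals[OF *])
  show "Re (logL z) > 0" by (rule Re_logL_pos[OF *])
  then show "logL z \<noteq> 0" by fastforce
  show "1 - z \<noteq> 0" using *(2) by simp
qed

lemma bounded_oscillation_Hinf: "bounded_oscillation \<in> Hinf"
proof -
  have "bounded_oscillation holomorphic_on unit_disk"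
    by (rule holomorphic_transform[of "\<lambda>z. exp (\<i> * Ln (1 - z))"])
       (auto simp: bounded_oscillation_def disk_facts intro!: holomorphic_intros)
  moreover have "norm (bounded_oscillation z) \<le> exp pi" if "z \<in> unit_disk" for z
    using norm_exp_i_Ln_le[of "1 - z" \<i>] disk_facts(4)[OF that] that
    by (simp only: bounded_oscillation_def restrict_apply if_True) simp
  moreover have "bounded_oscillation \<in> extensional unit_disk"
    by (simp add: bounded_oscillation_def)
  ultimately show ?thesis
    by (auto simp: Hinf_def H_disk_def bounded_iff intro!: exI[of _ "exp pi"])
qed

lemma oscillating_symbol_tendsto_0:
  "((\<lambda>z. exp (- \<i> * Ln (1 - z)) / logL z) \<longlongrightarrow> 0) (at 1)"
proof (rule Lim_null_comparison)
  show "\<forall>\<^sub>F z in at (1 :: complex).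
      norm (exp (- \<i> * Ln (1 - z)) / logL z) \<le> exp pi / (1 - ln (norm (1 - z)))"
  proof -
    have "\<forall>\<^sub>F z in at (1 :: complex). z \<in> ball 1 1 - {1}"
      by (rule eventually_at_in_open) auto
    then show ?thesis
    proof eventually_elim
      fix z :: complex assume z: "z \<in> ball 1 1 - {1}"
      then have n: "0 < norm (1 - z)" "norm (1 - z) < 1"
        by (auto simp: dist_norm)
      then have "0 < 1 - ln (norm (1 - z))"
        using ln_less_zero[OF n] by linarith
      moreover have "1 - ln (norm (1 - z)) \<le> norm (logL z)"
        using complex_Re_le_cmod[of "logL z"] z by simp
      ultimately show "norm (exp (- \<i> * Ln (1 - z)) / logL z) \<le> exp pi / (1 - ln (norm (1 - z)))"
        unfolding norm_divide using norm_exp_i_Ln_le[of "1 - z" "- \<i>"] z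
        by (intro frac_le) auto
    qed
  qed
  have "filterlim (\<lambda>z :: complex. norm (1 - z)) (at_right 0) (at 1)"
    unfolding filterlim_at
    by (auto intro!: tendsto_eq_intros simp: eventually_at_filter)
  moreover have "((\<lambda>x :: real. exp pi / (1 - ln x)) \<longlongrightarrow> 0) (at_right 0)"
    by real_asymp
  ultimately show "((\<lambda>z :: complex. exp pi / (1 - ln (norm (1 - z)))) \<longlongrightarrow> 0) (at 1)"
    by (rule filterlim_compose[rotated])
qed

lemma oscillating_symbol_disk_algebra: "oscillating_symbol \<in> disk_algebra"
proof -
  let ?g = "\<lambda>z. exp (- \<i> * Ln (1 - z)) / logL z"
  define h where "h = (\<lambda>z. if z = 1 then 0 else ?g z)"
  have "continuous (at z within cball 0 1) h" if z: "z \<in> cball 0 1" for z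
  proof (cases "z = 1")
    case True
    have "(h \<longlongrightarrow> 0) (at 1)"
      using oscillating_symbol_tendsto_0
      by (rule Lim_transform_eventually) (auto simp: h_def eventually_at_filter)
    then have "isCont h 1"
      by (simp add: isCont_def h_def)
    then show ?thesis
      using True continuous_at_imp_continuous_at_within by blast
  next
    case False
    have "logL z \<noteq> 0"
      using Re_logL_pos[OF z False] by fastforce
    then have "isCont ?g z"
      using one_minus_nonpos_Reals[OF z False] by (intro continuous_intros) auto
    moreover have "\<forall>\<^sub>F x in nhds z. h x = ?g x"
      by (rule eventually_mono[OF t1_space_nhds[OF False]]) (simp add: h_def)
    ultimately have "isCont h z"
      using isCont_cong[of h ?g z] by simp
    then show ?thesis
      using continuous_at_imp_continuous_at_within by blast
  qed
  then have "continuous_on (closure unit_disk) h"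
    by (simp add: continuous_on_eq_continuous_within)
  moreover have "oscillating_symbol holomorphic_on unit_disk"
    by (rule holomorphic_transform[of ?g])
       (use disk_facts in \<open>auto simp: oscillating_symbol_def intro!: holomorphic_intros\<close>)
  ultimately show ?thesis
    by (auto simp: disk_algebra_def H_disk_def oscillating_symbol_def h_def intro!: exI[of _ h])
qed

text \<open>
  The factor \<open>exp (\<i> Ln (1 - z))\<close> cancels the oscillation of the derivative of the symbol and leaves
  the integrand \<open>(\<i> / L - 1 / L\<^sup>2) / (1 - z)\<close> with \<open>L = logL z\<close>; since \<open>L\<close> has derivative
  \<open>1 / (1 - z)\<close>, this is the derivative of \<open>\<i> Ln L + 1 / L\<close>.
\<close>

lemma T_op_oscillating_symbol:
  assumes "z \<in> unit_disk"
  shows "T_op oscillating_symbol bounded_oscillation z = \<i> * Ln (logL z) + 1 / logL z - 1"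
proof -
  have "((\<lambda>z. \<i> * Ln (logL z) + 1 / logL z) has_field_derivative
      bounded_oscillation x * deriv oscillating_symbol x) (at x)" if x: "x \<in> unit_disk" for x
  proof -
    note df = disk_facts[OF x]
    have L: "logL x \<notin> \<real>\<^sub>\<le>\<^sub>0"
      using df(2) by (auto simp: complex_nonpos_Reals_iff)
    define u E V where "u = 1 - x" and "E = Ln (1 - x)" and "V = logL x"
    have nz: "u \<noteq> 0" "V \<noteq> 0"
      using df by (auto simp: u_def V_def)
    have dLn: "((\<lambda>z. Ln (1 - z)) has_field_derivative - (1 / u)) (at x)"
      using df(1,4) unfolding u_def by (auto intro!: derivative_eq_intros simp: field_simps)
    have dexp: "((\<lambda>z. exp (- \<i> * Ln (1 - z))) has_field_derivative
        exp (- \<i> * E) * (\<i> / u)) (at x)"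
      unfolding E_def by (rule derivative_eq_intros dLn refl)+ simp
    have dlogL: "(logL has_field_derivative 1 / u) (at x)"
      by (rule derivative_eq_intros dLn refl)+ simp
    have "((\<lambda>z. exp (- \<i> * Ln (1 - z)) / logL z) has_field_derivative
        (exp (- \<i> * E) * (\<i> / u) * V - exp (- \<i> * E) * (1 / u)) / (V * V)) (at x)"
      unfolding V_def E_def by (rule DERIV_divide[OF dexp[unfolded E_def] dlogL df(3)])
    moreover have "(exp (- \<i> * E) * (\<i> / u) * V - exp (- \<i> * E) * (1 / u)) / (V * V)
        = exp (- \<i> * E) * ((\<i> / V - 1 / V\<^sup>2) / u)"
      using nz by (simp add: field_simps power2_eq_square)
    ultimately have "((\<lambda>z. exp (- \<i> * Ln (1 - z)) / logL z) has_field_derivative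
        exp (- \<i> * E) * ((\<i> / V - 1 / V\<^sup>2) / u)) (at x)"
      by metis
    then have "(oscillating_symbol has_field_derivative
        exp (- \<i> * E) * ((\<i> / V - 1 / V\<^sup>2) / u)) (at x)"
      by (rule has_field_derivative_transform_within_open[OF _ open_ball x])
         (simp add: oscillating_symbol_def)
    then have "deriv oscillating_symbol x = exp (- \<i> * E) * ((\<i> / V - 1 / V\<^sup>2) / u)"
      by (rule DERIV_imp_deriv)
    then have "bounded_oscillation x * deriv oscillating_symbol x
        = (exp (\<i> * E) * exp (- \<i> * E)) * ((\<i> / V - 1 / V\<^sup>2) / u)"
      using x by (simp add: bounded_oscillation_def E_def)
    also have "exp (\<i> * E) * exp (- \<i> * E) = 1"
      by (simp flip: exp_add)
    finally have eq: "bounded_oscillation x * deriv oscillating_symbol x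
        = \<i> * (inverse V * (1 / u)) + (0 * V - 1 * (1 / u)) / (V * V)"
      using nz by (simp add: field_simps power2_eq_square)
    have "((\<lambda>z. Ln (logL z)) has_field_derivative inverse V * (1 / u)) (at x)"
      unfolding V_def using DERIV_chain2[OF has_field_derivative_Ln[OF L] dlogL] .
    from DERIV_add[OF DERIV_cmult[OF this] DERIV_divide[OF DERIV_const dlogL df(3)]]
    show ?thesis
      unfolding eq V_def .
  qed
  from T_op_eq_primitive[OF this assms] show ?thesis by simp
qed

lemma T_op_oscillating_symbol_unbounded:
  "T_op oscillating_symbol bounded_oscillation \<notin> Hinf"
proof
  assume "T_op oscillating_symbol bounded_oscillation \<in> Hinf"
  then obtain B where B:
    "\<And>z. z \<in> unit_disk \<Longrightarrow> norm (T_op oscillating_symbol bounded_oscillation z) \<le> B"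
    unfolding Hinf_def bounded_iff by blast
  \<comment> \<open>The point of the radius at which \<open>logL\<close> takes the value \<open>exp t\<close>.\<close>
  define t where "t = \<bar>B\<bar> + 1"
  define z where "z = complex_of_real (1 - exp (1 - exp t))"
  have "exp t > 1"
    by (simp add: t_def)
  then have "exp (1 - exp t) < 1"
    by simp
  then have z: "z \<in> unit_disk"
    by (simp add: z_def del: of_real_diff)
  have "Ln (1 - z) = of_real (1 - exp t)"
    by (simp add: z_def Ln_of_real)
  then have L: "logL z = of_real (exp t)"
    by simp
  have "Im (T_op oscillating_symbol bounded_oscillation z) = t"
    unfolding T_op_oscillating_symbol[OF z] L by (simp add: Ln_of_real Im_divide)
  then have "t \<le> B"
    using abs_Im_le_cmod[of "T_op oscillating_symbol bounded_oscillation z"] B[OF z] by linarith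
  then show False
    by (simp add: t_def)
qed

theorem theorem3p5:
  shows "T_compact \<subset> disk_algebra"
proof -
  have "oscillating_symbol \<notin> T_compact"
    using T_op_oscillating_symbol_unbounded bounded_oscillation_Hinf
    by (auto simp: T_compact_def compact_operator_Hinf_def)
  then show ?thesis
    using T_compact_subset_disk_algebra oscillating_symbol_disk_algebra by blast
qed

end
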